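(* Let $F$ be either the graph $P_2\cup P_4$ or the diamond. Then no minimally nonperfectly divisible $F$-free graph contains a homogeneous set.
   Context: Graphs are finite and simple. $P_n$ is the path on $n$ vertices; $P_2\cup P_4$ is the disjoint union of $P_2$ and $P_4$; the diamond is $K_4$ minus an edge. $G$ is $F$-free if no induced subgraph of $G$ is isomorphic to $F$. A perfect division of $G$ is a partition $(A,B)$ of $V(G)$ such that $G[A]$ is perfect and $\omega(G[B])<\omega(G)$. $G$ is perfectly divisible if every nonempty induced subgraph has a perfect division; $G$ is minimally nonperfectly divisible if $G$ is not perfectly divisible but every proper induced subgraph is. A homogeneous set of $G$ is a set $X\subseteq V(G)$ with $1<|X|<|V(G)|$ such that every vertex outside $X$ is adjacent to all or to none of the vertices of $X$. *)

theory Defs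
  imports "Graph_Theory.Graph_Theory"
begin

text \<open>
  A finite simple graph is a digraph satisfying the locale \<open>graph\<close>: finite, loop-free,
  symmetric and without parallel arcs, so that every undirected edge is a pair of
  opposite arcs. Adjacency of \<open>u\<close> and \<open>v\<close> is \<open>u \<rightarrow>\<^bsub>G\<^esub> v\<close>.
\<close>

definition clique :: "('a, 'b) pre_digraph \<Rightarrow> 'a set \<Rightarrow> bool" where
  "clique G K \<longleftrightarrow> K \<subseteq> verts G \<and> (\<forall>u\<in>K. \<forall>v\<in>K. u \<noteq> v \<longrightarrow> u \<rightarrow>\<^bsub>G\<^esub> v)"

definition clique_number :: "('a, 'b) pre_digraph \<Rightarrow> nat" where
  "clique_number G = Max {card K | K. clique G K}"

definition proper_colouring :: "('a, 'b) pre_digraph \<Rightarrow> nat \<Rightarrow> ('a \<Rightarrow> nat) \<Rightarrow> bool" where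
  "proper_colouring G k c \<longleftrightarrow>
     (\<forall>v\<in>verts G. c v < k) \<and>
     (\<forall>u\<in>verts G. \<forall>v\<in>verts G. u \<rightarrow>\<^bsub>G\<^esub> v \<longrightarrow> c u \<noteq> c v)"

definition chromatic_number :: "('a, 'b) pre_digraph \<Rightarrow> nat" where
  "chromatic_number G = (LEAST k. \<exists>c. proper_colouring G k c)"

text \<open>The empty graph counts as an induced subgraph here, which is harmless: both numbers are 0.\<close>

definition perfect :: "('a, 'b) pre_digraph \<Rightarrow> bool" where
  "perfect G \<longleftrightarrow> (\<forall>H. induced_subgraph H G \<longrightarrow> chromatic_number H = clique_number H)"

text \<open>One of the two parts may be empty; a nonempty perfect graph has the perfect division
  with \<open>B = {}\<close>.\<close>

definition perfect_division :: "('a, 'b) pre_digraph \<Rightarrow> 'a set \<Rightarrow> 'a set \<Rightarrow> bool" where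
  "perfect_division G A B \<longleftrightarrow>
     A \<union> B = verts G \<and> A \<inter> B = {} \<and>
     perfect (G \<restriction> A) \<and> clique_number (G \<restriction> B) < clique_number G"

definition perfectly_divisible :: "('a, 'b) pre_digraph \<Rightarrow> bool" where
  "perfectly_divisible G \<longleftrightarrow>
     (\<forall>H. induced_subgraph H G \<and> verts H \<noteq> {} \<longrightarrow> (\<exists>A B. perfect_division H A B))"

definition minimally_nonperfectly_divisible :: "('a, 'b) pre_digraph \<Rightarrow> bool" where
  "minimally_nonperfectly_divisible G \<longleftrightarrow>
     \<not> perfectly_divisible G \<and>
     (\<forall>H. induced_subgraph H G \<and> H \<noteq> G \<longrightarrow> perfectly_divisible H)"

definition homogeneous_set :: "('a, 'b) pre_digraph \<Rightarrow> 'a set \<Rightarrow> bool" where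
  "homogeneous_set G X \<longleftrightarrow>
     X \<subseteq> verts G \<and> 1 < card X \<and> card X < card (verts G) \<and>
     (\<forall>v\<in>verts G - X. (\<forall>x\<in>X. v \<rightarrow>\<^bsub>G\<^esub> x) \<or> (\<forall>x\<in>X. \<not> v \<rightarrow>\<^bsub>G\<^esub> x))"

definition free_of :: "('c, 'd) pre_digraph \<Rightarrow> ('a, 'b) pre_digraph \<Rightarrow> bool" where
  "free_of F G \<longleftrightarrow> \<not> (\<exists>H. induced_subgraph H G \<and> digraph_iso H F)"

text \<open>\<open>path_graph n\<close> has \<open>n\<close> vertices (not \<open>n\<close> edges).\<close>

definition path_graph :: "nat \<Rightarrow> nat pair_pre_digraph" where
  "path_graph n = \<lparr> pverts = {..<n}, parcs = {(i, j). i < n \<and> j < n \<and> (j = Suc i \<or> i = Suc j)} \<rparr>"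

definition disjoint_union ::
    "'a pair_pre_digraph \<Rightarrow> 'b pair_pre_digraph \<Rightarrow> ('a + 'b) pair_pre_digraph" where
  "disjoint_union G H =
     \<lparr> pverts = pverts G <+> pverts H,
       parcs = map_prod Inl Inl ` parcs G \<union> map_prod Inr Inr ` parcs H \<rparr>"

definition diamond :: "nat pair_pre_digraph" where
  "diamond = \<lparr> pverts = {..<4}, parcs = {(i, j). i < 4 \<and> j < 4 \<and> i \<noteq> j} - {(0, 1), (1, 0)} \<rparr>"

lemma pair_graph_path_graph: "pair_graph (path_graph n)"
proof -
  have "parcs (path_graph n) \<subseteq> {..<n} \<times> {..<n}"
    by (auto simp: path_graph_def)
  then have "finite (parcs (path_graph n))"
    by (rule finite_subset) simp
  then show ?thesis
    by unfold_locales (auto simp: path_graph_def symmetric_def sym_def)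
qed

lemma pair_graph_disjoint_union:
  assumes "pair_graph G" "pair_graph H"
  shows "pair_graph (disjoint_union G H)"
proof -
  interpret G: pair_graph G by fact
  interpret H: pair_graph H by fact
  show ?thesis
  proof unfold_locales
    show "symmetric (with_proj (disjoint_union G H))"
      unfolding symmetric_def
      by (rule symI) (force simp: disjoint_union_def dest: G.arcs_symmetric H.arcs_symmetric)
  qed (use G.pair_finite_verts G.pair_finite_arcs H.pair_finite_verts H.pair_finite_arcs in
      \<open>auto simp: disjoint_union_def dest: G.in_arcsD1 G.in_arcsD2 H.in_arcsD1 H.in_arcsD2
        G.no_loops' H.no_loops'\<close>)
qed

lemma pair_graph_diamond: "pair_graph diamond"
proof -
  have "parcs diamond \<subseteq> {..<4} \<times> {..<4}"
    by (auto simp: diamond_def)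
  then have "finite (parcs diamond)"
    by (rule finite_subset) simp
  then show ?thesis
    by unfold_locales (auto simp: diamond_def symmetric_def sym_def)
qed

end

theory Submission
  imports Defs
begin

text \<open>
  Let \<open>X\<close> be a homogeneous set, \<open>N\<close> the set of outside vertices complete to \<open>X\<close>, and \<open>M\<close> the set of
  those anticomplete to \<open>X\<close>. If \<open>X\<close> is stable it contains false twins, and a perfect division
  survives adding a false twin. So let \<open>X\<close> contain an edge.

  If \<open>G\<close> is \<open>P\<^sub>2 \<union> P\<^sub>4\<close>-free then \<open>M\<close> is \<open>P\<^sub>4\<close>-free, hence perfect. A perfect division \<open>(A, B)\<close> of
  \<open>X\<close> then yields the perfect division \<open>(A \<union> M, B \<union> N)\<close> of \<open>G\<close>, since
  \<open>\<omega>(B \<union> N) \<le> \<omega>(B) + \<omega>(N) < \<omega>(X) + \<omega>(N) = \<omega>(X \<union> N)\<close>.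

  If \<open>G\<close> is diamond-free and \<open>N = {}\<close>, then \<open>G\<close> is disconnected and perfect divisions of \<open>X\<close> and
  \<open>M\<close> can be united. Otherwise \<open>X\<close> induces a disjoint union of cliques and \<open>N\<close> is a
  clique, so that an end of an edge in \<open>X\<close> is simplicial in \<open>G\<close>; a perfect division survives adding
  a simplicial vertex.
\<close>

section \<open>Induced subgraphs as vertex subsets\<close>

lemma (in wf_digraph) induced_subgraph_iff:
  "induced_subgraph H G \<longleftrightarrow> (\<exists>S\<subseteq>verts G. H = G \<restriction> S)"
proof
  assume H: "induced_subgraph H G"
  then have "verts H \<subseteq> verts G" by (auto simp: induced_subgraph_def subgraph_def)
  moreover have "H = G \<restriction> verts H" using induce_eq_iff_induced[OF H] by simp
  ultimately show "\<exists>S\<subseteq>verts G. H = G \<restriction> S" by blast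
qed (auto simp: induced_induce)

lemma induce_subgraph_induce_subgraph: "T \<subseteq> S \<Longrightarrow> (G \<restriction> S) \<restriction> T = G \<restriction> T"
  by (auto simp: induce_subgraph_def)

lemma (in wf_digraph) induced_subgraph_induce_iff:
  "induced_subgraph H (G \<restriction> S) \<longleftrightarrow> (\<exists>T\<subseteq>S. H = G \<restriction> T)"
proof -
  interpret S: wf_digraph "G \<restriction> S" by (rule wellformed_induce_subgraph)
  show ?thesis
    unfolding S.induced_subgraph_iff induce_subgraph_verts
    by (intro iff_exI conj_cong refl) (simp add: induce_subgraph_induce_subgraph)
qed

lemma dominates_induce_subgraph_iff:
  "u \<rightarrow>\<^bsub>G \<restriction> S\<^esub> v \<longleftrightarrow> u \<in> S \<and> v \<in> S \<and> u \<rightarrow>\<^bsub>G\<^esub> v"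
  by (auto simp: arcs_ends_conv)

lemma clique_induce_subgraph: "S \<subseteq> verts G \<Longrightarrow> clique (G \<restriction> S) K \<longleftrightarrow> K \<subseteq> S \<and> clique G K"
  unfolding clique_def dominates_induce_subgraph_iff induce_subgraph_verts by blast

lemma proper_colouring_induce_subgraph:
  "proper_colouring (G \<restriction> S) k c \<longleftrightarrow>
    (\<forall>v\<in>S. c v < k) \<and> (\<forall>u\<in>S. \<forall>v\<in>S. u \<rightarrow>\<^bsub>G\<^esub> v \<longrightarrow> c u \<noteq> c v)"
  unfolding proper_colouring_def dominates_induce_subgraph_iff induce_subgraph_verts by blast

text \<open>An adjacency-preserving and adjacency-reflecting embedding \<open>f\<close> of
  \<open>F\<close> yields the isomorphism asked for by \<open>free_of\<close>. It goes from the
  subgraph induced by the image of \<open>f\<close> back to \<open>F\<close>: vertices are mapped by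
  the inverse of \<open>f\<close>, arcs to the pairs of images of their ends. Since \<open>G\<close>
  has no parallel arcs, the arc map is injective.\<close>

lemma not_free_ofI:
  assumes "nomulti_digraph G" "pair_wf_digraph F"
    and inj: "inj_on f (pverts F)" and verts: "f ` pverts F \<subseteq> verts G"
    and adj: "\<And>i j. \<lbrakk>i \<in> pverts F; j \<in> pverts F\<rbrakk> \<Longrightarrow> f i \<rightarrow>\<^bsub>G\<^esub> f j \<longleftrightarrow> (i, j) \<in> parcs F"
  shows "\<not> free_of (with_proj F) G"
proof -
  interpret G: nomulti_digraph G by fact
  interpret F: pair_wf_digraph F by fact
  define S where "S = f ` pverts F"
  define g where "g = the_inv_into (pverts F) f"
  have gf: "g (f i) = i" if "i \<in> pverts F" for i
    unfolding g_def using inj that by (rule the_inv_into_f_f)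
  have S: "S \<subseteq> verts G" using verts by (simp add: S_def)
  \<comment> \<open>The arcs of \<open>with_proj F\<close> are ordered pairs, so the new tail and
    head maps are the projections.\<close>
  define hom where "hom = \<lparr>iso_verts = g, iso_arcs = (\<lambda>e. (g (tail G e), g (head G e))),
    iso_head = snd, iso_tail = fst\<rparr>"
  have inj_g: "inj_on g S"
    by (auto simp: S_def gf inj_on_def)
  have "inj_on (\<lambda>e. (g (tail G e), g (head G e))) (arcs (G \<restriction> S))"
  proof (rule inj_onI)
    fix d e assume "d \<in> arcs (G \<restriction> S)" "e \<in> arcs (G \<restriction> S)"
      and "(g (tail G d), g (head G d)) = (g (tail G e), g (head G e))"
    then show "d = e"
      using inj_g by (auto dest: inj_onD intro!: G.no_multi_arcs simp: arc_to_ends_def)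
  qed
  then have iso: "pre_digraph.digraph_isomorphism (G \<restriction> S) hom"
    using inj_g by (auto simp: pre_digraph.digraph_isomorphism_def hom_def)
  have "(\<lambda>e. (g (tail G e), g (head G e))) ` arcs (G \<restriction> S) = parcs F" (is "?L = _")
  proof (intro equalityI subsetI)
    fix p assume "p \<in> ?L"
    then obtain e i j where e: "e \<in> arcs G" "tail G e = f i" "head G e = f j"
      and ij: "i \<in> pverts F" "j \<in> pverts F" and p: "p = (g (f i), g (f j))"
      by (auto simp: S_def)
    from e have "f i \<rightarrow>\<^bsub>G\<^esub> f j" by (metis G.in_arcs_imp_in_arcs_ends)
    with adj ij show "p \<in> parcs F" by (simp add: p gf)
  next
    fix p assume p: "p \<in> parcs F"
    obtain i j where [simp]: "p = (i, j)" by force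
    have ij: "i \<in> pverts F" "j \<in> pverts F"
      using p F.in_arcsD1 F.in_arcsD2 by auto
    with p adj have "f i \<rightarrow>\<^bsub>G\<^esub> f j" by auto
    then obtain e where "e \<in> arcs G" "tail G e = f i" "head G e = f j"
      by (auto simp: arcs_ends_conv)
    with ij show "p \<in> ?L" by (force simp: S_def gf image_iff)
  qed
  moreover have "g ` S = pverts F"
    by (force simp: S_def gf)
  ultimately have "with_proj F = app_iso hom (G \<restriction> S)"
    by (intro pre_digraph.equality) (simp_all add: hom_def)
  with iso have "digraph_iso (G \<restriction> S) (with_proj F)"
    by (auto simp: digraph_iso_def)
  with G.induced_induce[OF S] show ?thesis
    by (auto simp: free_of_def)
qed

section \<open>Cliques and the clique number of vertex subsets\<close>

context graph
begin

abbreviation omega :: "'a set \<Rightarrow> nat" where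
  "omega S \<equiv> clique_number (G \<restriction> S)"

definition colourable :: "nat \<Rightarrow> 'a set \<Rightarrow> bool" where
  "colourable k S \<longleftrightarrow> (\<exists>c. proper_colouring (G \<restriction> S) k c)"

text \<open>This speaks of perfect divisions of induced subgraphs through vertex sets of the fixed
  graph \<open>G\<close>, so that no argument has to pass to another graph;
  \<open>perfect_division_iff_divisible\<close> is the link.\<close>

definition divisible :: "'a set \<Rightarrow> bool" where
  "divisible S \<longleftrightarrow> (\<exists>A B. A \<union> B = S \<and> A \<inter> B = {} \<and> perfect (G \<restriction> A) \<and> omega B < omega S)"

definition stable :: "'a set \<Rightarrow> bool" where
  "stable S \<longleftrightarrow> (\<forall>u\<in>S. \<forall>v\<in>S. \<not> u \<rightarrow>\<^bsub>G\<^esub> v)"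

lemma adj_sym: "u \<rightarrow>\<^bsub>G\<^esub> v \<Longrightarrow> v \<rightarrow>\<^bsub>G\<^esub> u"
  using sym_arcs by (rule arcs_ends_symmetric)

lemma adj_irrefl [simp]: "\<not> u \<rightarrow>\<^bsub>G\<^esub> u"
  by (auto dest: adj_not_same)

lemma clique_subset: "clique G K \<Longrightarrow> L \<subseteq> K \<Longrightarrow> clique G L"
  by (auto simp: clique_def)

lemma clique_finite: "clique G K \<Longrightarrow> finite K"
  using finite_verts by (auto simp: clique_def intro: finite_subset)

lemma clique_insert:
  "clique G (insert x K) \<longleftrightarrow> x \<in> verts G \<and> clique G K \<and> (\<forall>v\<in>K - {x}. x \<rightarrow>\<^bsub>G\<^esub> v)"
proof -
  have "v \<rightarrow>\<^bsub>G\<^esub> x \<longleftrightarrow> x \<rightarrow>\<^bsub>G\<^esub> v" for v using adj_sym by blast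
  then show ?thesis unfolding clique_def by blast
qed

lemma finite_clique_cards:
  assumes "S \<subseteq> verts G"
  shows "finite {card K | K. clique (G \<restriction> S) K}"
proof -
  have "finite S" using assms finite_verts by (rule finite_subset)
  then have "finite (card ` Pow S)" by simp
  then show ?thesis
    by (rule rev_finite_subset) (auto simp: clique_def)
qed

lemma card_clique_le_omega:
  assumes "S \<subseteq> verts G" "clique G K" "K \<subseteq> S"
  shows "card K \<le> omega S"
  unfolding clique_number_def using assms
  by (intro Max_ge[OF finite_clique_cards]) (auto simp: clique_induce_subgraph)

lemma omega_cliqueE:
  assumes "S \<subseteq> verts G"
  obtains K where "clique G K" "K \<subseteq> S" "card K = omega S"
proof -
  have "clique (G \<restriction> S) {}" by (simp add: clique_def)
  then have "{card K | K. clique (G \<restriction> S) K} \<noteq> {}" by blast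
  from Max_in[OF finite_clique_cards[OF assms] this]
  obtain K where "clique (G \<restriction> S) K" "card K = omega S"
    by (auto simp: clique_number_def)
  with assms that show thesis by (auto simp: clique_induce_subgraph)
qed

lemma omega_mono:
  assumes "S \<subseteq> T" "T \<subseteq> verts G"
  shows "omega S \<le> omega T"
proof -
  have "S \<subseteq> verts G" using assms by blast
  then obtain K where "clique G K" "K \<subseteq> S" "card K = omega S" by (rule omega_cliqueE)
  with assms card_clique_le_omega[of T K] show ?thesis by simp
qed

text \<open>A maximum clique of the union meets each of the two sets in a clique.\<close>

lemma omega_Un_le:
  assumes "S \<subseteq> verts G" "T \<subseteq> verts G"
  shows "omega (S \<union> T) \<le> omega S + omega T"
proof -
  obtain K where K: "clique G K" "K \<subseteq> S \<union> T" "card K = omega (S \<union> T)"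
    using assms(1,2) omega_cliqueE[of "S \<union> T"] by (metis Un_least)
  have "card K \<le> card (K \<inter> S) + card (K \<inter> T)"
    using K(2) card_Un_le[of "K \<inter> S" "K \<inter> T"] by (simp flip: Int_Un_distrib add: Int_absorb2)
  also have "\<dots> \<le> omega S + omega T"
    using assms K(1) by (intro add_mono card_clique_le_omega) (auto intro: clique_subset)
  finally show ?thesis using K(3) by simp
qed

text \<open>Maximum cliques of the two sides are disjoint, as there are no loops, and their union is
  again a clique.\<close>

lemma omega_join_ge:
  assumes "S \<subseteq> verts G" "T \<subseteq> verts G"
    and "\<And>u v. \<lbrakk>u \<in> S; v \<in> T\<rbrakk> \<Longrightarrow> u \<rightarrow>\<^bsub>G\<^esub> v"
  shows "omega S + omega T \<le> omega (S \<union> T)"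
proof -
  obtain K L where KL: "clique G K" "K \<subseteq> S" "card K = omega S"
      "clique G L" "L \<subseteq> T" "card L = omega T"
    using assms by (meson omega_cliqueE)
  have "K \<inter> L = {}" using KL assms(3) adj_irrefl by blast
  then have "omega S + omega T = card (K \<union> L)"
    using KL by (simp add: card_Un_disjoint clique_finite)
  also have "\<dots> \<le> omega (S \<union> T)"
  proof (rule card_clique_le_omega)
    have "\<And>u v. \<lbrakk>u \<in> K; v \<in> L\<rbrakk> \<Longrightarrow> u \<rightarrow>\<^bsub>G\<^esub> v \<and> v \<rightarrow>\<^bsub>G\<^esub> u"
      using KL assms(3) adj_sym by blast
    then show "clique G (K \<union> L)"
      using KL by (auto simp: clique_def)
  qed (use KL assms in auto)
  finally show ?thesis .
qed

text \<open>A clique containing a vertex outside \<open>T\<close> and one outside \<open>S\<close>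
  would contain an edge between the two sides, so every clique lies in \<open>S\<close> or in
  \<open>T\<close>.\<close>

lemma omega_anticomplete_less:
  assumes "S \<subseteq> verts G" "T \<subseteq> verts G"
    and anti: "\<And>u v. \<lbrakk>u \<in> S; v \<in> T\<rbrakk> \<Longrightarrow> \<not> u \<rightarrow>\<^bsub>G\<^esub> v"
    and "omega S < k" "omega T < k"
  shows "omega (S \<union> T) < k"
proof -
  obtain K where K: "clique G K" "K \<subseteq> S \<union> T" "card K = omega (S \<union> T)"
    using assms(1,2) omega_cliqueE[of "S \<union> T"] by (metis Un_least)
  have "K \<subseteq> S \<or> K \<subseteq> T"
  proof (rule ccontr)
    assume "\<not> (K \<subseteq> S \<or> K \<subseteq> T)"
    then obtain u v where "u \<in> K" "u \<notin> T" "v \<in> K" "v \<notin> S" by blast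
    with K(2) have "u \<in> S" "v \<in> T" "u \<noteq> v" by auto
    moreover from this have "u \<rightarrow>\<^bsub>G\<^esub> v"
      using K(1) \<open>u \<in> K\<close> \<open>v \<in> K\<close> by (auto simp: clique_def)
    ultimately show False using anti by blast
  qed
  then show ?thesis
    using K(1,3) assms(1,2,4,5) card_clique_le_omega[of S K] card_clique_le_omega[of T K] by auto
qed

section \<open>Colourings and perfection\<close>

lemma colourable_mono:
  assumes "colourable k S" "k \<le> l" "T \<subseteq> S"
  shows "colourable l T"
proof -
  obtain c where "proper_colouring (G \<restriction> S) k c"
    using assms(1) by (auto simp: colourable_def)
  then have "proper_colouring (G \<restriction> T) l c"
    using assms(2,3) unfolding proper_colouring_induce_subgraph
    by (metis order_less_le_trans subsetD)
  then show ?thesis by (auto simp: colourable_def)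
qed

lemma omega_le_if_colourable:
  assumes "S \<subseteq> verts G" "colourable k S"
  shows "omega S \<le> k"
proof -
  obtain K where K: "clique G K" "K \<subseteq> S" "card K = omega S"
    using assms(1) by (rule omega_cliqueE)
  obtain c where c: "proper_colouring (G \<restriction> S) k c"
    using assms(2) by (auto simp: colourable_def)
  have "inj_on c K"
    using K(1,2) c unfolding inj_on_def clique_def proper_colouring_induce_subgraph by blast
  moreover have "c ` K \<subseteq> {..<k}"
    using K(2) c by (auto simp: proper_colouring_induce_subgraph)
  ultimately have "card K \<le> card {..<k}" by (intro card_inj_on_le) auto
  with K(3) show ?thesis by simp
qed

lemma colourable_card:
  assumes "finite S"
  shows "colourable (card S) S"
proof -
  obtain c where c: "bij_betw c S {0..<card S}"
    using ex_bij_betw_finite_nat[OF assms] by blast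
  have "c v < card S" if "v \<in> S" for v
    using bij_betwE[OF c] that by auto
  moreover have "c u \<noteq> c v" if "u \<in> S" "v \<in> S" "u \<rightarrow>\<^bsub>G\<^esub> v" for u v
    using bij_betw_imp_inj_on[OF c] that by (metis adj_irrefl inj_onD)
  ultimately have "proper_colouring (G \<restriction> S) (card S) c"
    by (simp add: proper_colouring_induce_subgraph)
  then show ?thesis by (auto simp: colourable_def)
qed

text \<open>The clique number bounds the number of colours from below, so equality only asks for a
  colouring with that many colours. The colouring by \<open>card S\<close> colours guarantees that
  the least number in the definition is attained.\<close>

lemma chromatic_number_eq_omega_iff:
  assumes "S \<subseteq> verts G"
  shows "chromatic_number (G \<restriction> S) = omega S \<longleftrightarrow> colourable (omega S) S"
proof -
  have "finite S" using assms finite_verts by (rule finite_subset)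
  then have ex: "colourable (card S) S" by (rule colourable_card)
  have chi: "chromatic_number (G \<restriction> S) = (LEAST k. colourable k S)"
    by (simp add: chromatic_number_def colourable_def)
  show ?thesis
    unfolding chi
    by (metis LeastI[of "\<lambda>k. colourable k S", OF ex] Least_equality assms omega_le_if_colourable)
qed

text \<open>This is the working form of perfection: the proofs below only have to exhibit a
  colouring of each subset \<open>T\<close> with \<open>omega T\<close> colours.\<close>

lemma perfect_iff_colourable:
  assumes "S \<subseteq> verts G"
  shows "perfect (G \<restriction> S) \<longleftrightarrow> (\<forall>T\<subseteq>S. colourable (omega T) T)"
proof -
  have "perfect (G \<restriction> S) \<longleftrightarrow> (\<forall>T\<subseteq>S. chromatic_number (G \<restriction> T) = omega T)"
    unfolding perfect_def induced_subgraph_induce_iff by blast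
  with assms chromatic_number_eq_omega_iff show ?thesis by (metis dual_order.trans)
qed

section \<open>Operations that preserve perfection\<close>

text \<open>Colourings of the two parts of \<open>U\<close> both fit into a palette of size
  \<open>omega U\<close>, and gluing them creates no conflict because no edge joins the
  parts.\<close>

lemma perfect_anticomplete_Un:
  assumes "S \<subseteq> verts G" "T \<subseteq> verts G" "perfect (G \<restriction> S)" "perfect (G \<restriction> T)"
    and anti: "\<And>u v. \<lbrakk>u \<in> S; v \<in> T\<rbrakk> \<Longrightarrow> \<not> u \<rightarrow>\<^bsub>G\<^esub> v"
  shows "perfect (G \<restriction> (S \<union> T))"
proof -
  have "colourable (omega U) U" if U: "U \<subseteq> S \<union> T" for U
  proof -
    have "colourable (omega (U \<inter> S)) (U \<inter> S)" "colourable (omega (U \<inter> T)) (U \<inter> T)"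
      using assms by (auto simp: perfect_iff_colourable)
    moreover have "omega (U \<inter> S) \<le> omega U" "omega (U \<inter> T) \<le> omega U"
      using U assms by (auto intro!: omega_mono)
    ultimately have "colourable (omega U) (U \<inter> S)" "colourable (omega U) (U \<inter> T)"
      by (auto intro: colourable_mono)
    then obtain c d where c: "proper_colouring (G \<restriction> (U \<inter> S)) (omega U) c"
      and d: "proper_colouring (G \<restriction> (U \<inter> T)) (omega U) d"
      by (auto simp: colourable_def)
    have "proper_colouring (G \<restriction> U) (omega U) (\<lambda>v. if v \<in> S then c v else d v)"
      unfolding proper_colouring_induce_subgraph
    proof (intro conjI ballI impI)
      fix v assume "v \<in> U"
      with U have "v \<in> S \<or> v \<notin> S \<and> v \<in> T" by blast
      with c d \<open>v \<in> U\<close> show "(if v \<in> S then c v else d v) < omega U"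
        by (auto simp: proper_colouring_induce_subgraph)
    next
      fix u v assume uv: "u \<in> U" "v \<in> U" "u \<rightarrow>\<^bsub>G\<^esub> v"
      then have "v \<rightarrow>\<^bsub>G\<^esub> u" using adj_sym by blast
      with uv U anti have "u \<in> S \<and> v \<in> S \<or> u \<notin> S \<and> v \<notin> S \<and> u \<in> T \<and> v \<in> T" by blast
      with c d uv show "(if u \<in> S then c u else d u) \<noteq> (if v \<in> S then c v else d v)"
        by (auto simp: proper_colouring_induce_subgraph)
    qed
    then show ?thesis by (auto simp: colourable_def)
  qed
  with assms show ?thesis by (simp add: perfect_iff_colourable)
qed

text \<open>In a subset \<open>U\<close> containing \<open>x\<close>, the vertex \<open>x\<close> is
  exchanged for \<open>y\<close>; the result lies in \<open>S\<close> and can be coloured. Then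
  \<open>x\<close> receives the colour of \<open>y\<close>, which is proper because both have the
  same neighbours.\<close>

lemma perfect_insert_false_twin:
  assumes "S \<subseteq> verts G" "perfect (G \<restriction> S)" "x \<in> verts G" "y \<in> S"
    and twin: "\<And>v. x \<rightarrow>\<^bsub>G\<^esub> v \<longleftrightarrow> y \<rightarrow>\<^bsub>G\<^esub> v"
  shows "perfect (G \<restriction> insert x S)"
proof -
  have "colourable (omega U) U" if U: "U \<subseteq> insert x S" for U
  proof (cases "x \<in> U")
    case False
    with U assms show ?thesis by (auto simp: perfect_iff_colourable)
  next
    case True
    have UV: "U \<subseteq> verts G" using U assms by auto
    define W where "W = insert y (U - {x})"
    have W: "W \<subseteq> verts G" using U assms by (auto simp: W_def)
    have "W \<subseteq> S" using U assms(4) by (auto simp: W_def)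
    then have "colourable (omega W) W" using assms by (auto simp: perfect_iff_colourable)
    moreover have "omega W \<le> omega U"
    proof -
      obtain K where K: "clique G K" "K \<subseteq> W" "card K = omega W"
        using W by (rule omega_cliqueE)
      show ?thesis
      proof (cases "y \<in> K")
        case False
        with K UV card_clique_le_omega[of U K] show ?thesis by (auto simp: W_def)
      next
        case True
        \<comment> \<open>The vertex \<open>y\<close> need not belong to \<open>U\<close>, so a
          clique of \<open>W\<close> through \<open>y\<close> is brought back into \<open>U\<close>
          by exchanging \<open>y\<close> for \<open>x\<close>.\<close>
        have nbr: "x \<rightarrow>\<^bsub>G\<^esub> v" if "v \<in> K - {y}" for v
          using K(1) True twin[of v] that by (auto simp: clique_def)
        have "clique G (insert x (K - {y}))"
          using K(1) assms(3) nbr clique_subset[of K "K - {y}"] by (auto simp: clique_insert)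
        moreover have "insert x (K - {y}) \<subseteq> U"
          using K(2) \<open>x \<in> U\<close> by (auto simp: W_def)
        moreover have "card K \<le> card (insert x (K - {y}))"
        proof (cases "x = y")
          case True then show ?thesis using \<open>y \<in> K\<close> by (simp add: insert_absorb)
        next
          case False
          then have "x \<notin> K" using K(2) by (auto simp: W_def)
          then show ?thesis using K(1) True by (simp add: clique_finite card_Suc_Diff1)
        qed
        ultimately show ?thesis using K(3) card_clique_le_omega[OF UV] by force
      qed
    qed
    ultimately obtain c where c: "proper_colouring (G \<restriction> W) (omega U) c"
      using colourable_mono colourable_def by blast
    have "proper_colouring (G \<restriction> U) (omega U) (c(x := c y))"
      unfolding proper_colouring_induce_subgraph
    proof (intro conjI ballI impI)
      fix v assume "v \<in> U"
      then show "(c(x := c y)) v < omega U"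
        using c by (auto simp: proper_colouring_induce_subgraph W_def)
    next
      fix u v assume "u \<in> U" "v \<in> U" "u \<rightarrow>\<^bsub>G\<^esub> v"
      moreover have "u \<rightarrow>\<^bsub>G\<^esub> x \<Longrightarrow> u \<rightarrow>\<^bsub>G\<^esub> y" for u
        using twin adj_sym by blast
      ultimately show "(c(x := c y)) u \<noteq> (c(x := c y)) v"
        using c twin by (auto simp: proper_colouring_induce_subgraph W_def)
    qed
    then show ?thesis by (auto simp: colourable_def)
  qed
  with assms show ?thesis by (simp add: perfect_iff_colourable)
qed

text \<open>Twins are nonadjacent, so a clique containing \<open>x\<close> omits a twin
  \<open>y\<close> different from \<open>x\<close>; exchanging \<open>x\<close> for \<open>y\<close>
  gives a clique of the same size inside \<open>S\<close>.\<close>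

lemma omega_insert_false_twin:
  assumes "S \<subseteq> verts G" "x \<in> verts G" "y \<in> S"
    and twin: "\<And>v. x \<rightarrow>\<^bsub>G\<^esub> v \<longleftrightarrow> y \<rightarrow>\<^bsub>G\<^esub> v"
  shows "omega (insert x S) \<le> omega S"
proof -
  obtain K where K: "clique G K" "K \<subseteq> insert x S" "card K = omega (insert x S)"
    using assms(1,2) omega_cliqueE[of "insert x S"] by (metis insert_subset)
  show ?thesis
  proof (cases "x \<in> K \<and> x \<noteq> y")
    case False
    with K assms card_clique_le_omega[of S K] show ?thesis by auto
  next
    case True
    have "y \<rightarrow>\<^bsub>G\<^esub> v" if "v \<in> K - {x}" for v
      using K(1) True twin[of v] that by (auto simp: clique_def)
    then have "clique G (insert y (K - {x}))"
      using K(1) assms(1,3) clique_subset[of K "K - {x}"] by (auto simp: clique_insert)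
    moreover have "insert y (K - {x}) \<subseteq> S"
      using K(2) assms(3) by auto
    moreover have "y \<notin> K"
      using K(1) True twin[of y] by (auto simp: clique_def)
    then have "card K = card (insert y (K - {x}))"
      using K(1) True card_Suc_Diff1[of K x] by (simp add: clique_finite del: card_Diff_singleton)
    ultimately show ?thesis using K(3) card_clique_le_omega[OF assms(1)] by force
  qed
qed

text \<open>The neighbours of \<open>x\<close> in \<open>U\<close> form a clique together with
  \<open>x\<close>, so there are fewer than \<open>omega U\<close> of them. Hence a colouring of
  \<open>U - {x}\<close> leaves a colour free for \<open>x\<close>.\<close>

lemma perfect_insert_simplicial:
  assumes "S \<subseteq> verts G" "perfect (G \<restriction> S)" "x \<in> verts G"
    and simplicial: "clique G {v. x \<rightarrow>\<^bsub>G\<^esub> v}"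
  shows "perfect (G \<restriction> insert x S)"
proof -
  have "colourable (omega U) U" if U: "U \<subseteq> insert x S" for U
  proof (cases "x \<in> U")
    case False
    with U assms show ?thesis by (auto simp: perfect_iff_colourable)
  next
    case True
    have UV: "U \<subseteq> verts G" using U assms by auto
    have "U - {x} \<subseteq> S" using U by auto
    then have "colourable (omega (U - {x})) (U - {x})"
      using assms(1,2) by (simp add: perfect_iff_colourable)
    moreover have "omega (U - {x}) \<le> omega U"
      using UV by (intro omega_mono) auto
    ultimately obtain c where c: "proper_colouring (G \<restriction> (U - {x})) (omega U) c"
      using colourable_mono colourable_def by blast
    define L where "L = {v \<in> U. x \<rightarrow>\<^bsub>G\<^esub> v}"
    have "clique G L"
      using simplicial by (rule clique_subset) (auto simp: L_def)
    then have "clique G (insert x L)"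
      using assms(3) by (auto simp: clique_insert L_def)
    moreover have "insert x L \<subseteq> U" using True by (auto simp: L_def)
    ultimately have "card (insert x L) \<le> omega U" by (rule card_clique_le_omega[OF UV])
    then have "card L < omega U"
      using \<open>clique G L\<close> by (simp add: clique_finite L_def)
    then have "card (c ` L) < card {..<omega U}"
      using card_image_le[of L c] \<open>clique G L\<close> by (simp add: clique_finite)
    then obtain k where k: "k < omega U" "k \<notin> c ` L"
      by (metis card_mono clique_finite \<open>clique G L\<close> finite_imageI lessThan_iff not_le subsetI)
    have "proper_colouring (G \<restriction> U) (omega U) (c(x := k))"
      unfolding proper_colouring_induce_subgraph
    proof (intro conjI ballI impI)
      fix v assume "v \<in> U"
      then show "(c(x := k)) v < omega U"
        using c k by (auto simp: proper_colouring_induce_subgraph)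
    next
      fix u v assume uv: "u \<in> U" "v \<in> U" "u \<rightarrow>\<^bsub>G\<^esub> v"
      then have "v \<rightarrow>\<^bsub>G\<^esub> u" by (rule_tac adj_sym)
      with uv show "(c(x := k)) u \<noteq> (c(x := k)) v"
        using c k by (auto simp: proper_colouring_induce_subgraph L_def)
    qed
    then show ?thesis by (auto simp: colourable_def)
  qed
  with assms show ?thesis by (simp add: perfect_iff_colourable)
qed

section \<open>Perfection of \<open>P\<^sub>4\<close>-free graphs\<close>

text \<open>A violation is exactly an induced \<open>P\<^sub>4\<close>: if two of the four vertices
  coincide, the implication holds automatically, because adjacency is symmetric and
  irreflexive.\<close>

definition P4_free_on :: "'a set \<Rightarrow> bool" where
  "P4_free_on S \<longleftrightarrow> (\<forall>p\<in>S. \<forall>q\<in>S. \<forall>r\<in>S. \<forall>s\<in>S.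
     p \<rightarrow>\<^bsub>G\<^esub> q \<longrightarrow> q \<rightarrow>\<^bsub>G\<^esub> r \<longrightarrow> r \<rightarrow>\<^bsub>G\<^esub> s \<longrightarrow> p \<rightarrow>\<^bsub>G\<^esub> r \<or> q \<rightarrow>\<^bsub>G\<^esub> s \<or> p \<rightarrow>\<^bsub>G\<^esub> s)"

text \<open>Along a maximal clique disjoint from a maximal stable set \<open>S\<close> the neighbourhoods in \<open>S\<close> are
  nonempty and, by \<open>P\<^sub>4\<close>-freeness, nested; a vertex of the smallest one extends the clique.\<close>

lemma P4_free_clique_extends:
  assumes "T \<subseteq> verts G" "P4_free_on T" "S \<subseteq> T" "stable S"
    and max: "\<And>v. v \<in> T - S \<Longrightarrow> \<exists>s\<in>S. v \<rightarrow>\<^bsub>G\<^esub> s"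
    and "S \<noteq> {}" "clique G K" "K \<subseteq> T - S"
  shows "\<exists>s\<in>S. clique G (insert s K)"
proof (cases "K = {}")
  case True
  with assms show ?thesis by (auto simp: clique_def)
next
  case False
  define N where "N k = {s \<in> S. k \<rightarrow>\<^bsub>G\<^esub> s}" for k
  have "finite (N ` K)" "N ` K \<noteq> {}"
    using False \<open>clique G K\<close> by (auto simp: clique_finite)
  then obtain P where P: "P \<in> N ` K" "\<forall>Q\<in>N ` K. Q \<subseteq> P \<longrightarrow> P = Q"
    using finite_has_minimal[of "N ` K"] by auto
  then obtain k where k: "k \<in> K" "P = N k" by auto
  with P(2) have minimal: "N l = N k" if "l \<in> K" "N l \<subseteq> N k" for l
    using that by auto
  obtain s where s: "s \<in> S" "k \<rightarrow>\<^bsub>G\<^esub> s" using k(1) max assms(8) by blast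
  have "l \<rightarrow>\<^bsub>G\<^esub> s" if l: "l \<in> K" for l
  proof (rule ccontr)
    assume nls: "\<not> l \<rightarrow>\<^bsub>G\<^esub> s"
    then have "\<not> N l \<subseteq> N k" using minimal[OF l] s by (auto simp: N_def)
    then obtain t where t: "t \<in> S" "l \<rightarrow>\<^bsub>G\<^esub> t" "\<not> k \<rightarrow>\<^bsub>G\<^esub> t" by (auto simp: N_def)
    have "k \<rightarrow>\<^bsub>G\<^esub> l" using \<open>clique G K\<close> k(1) l nls s by (auto simp: clique_def)
    moreover have "\<not> s \<rightarrow>\<^bsub>G\<^esub> l" "s \<rightarrow>\<^bsub>G\<^esub> k" using nls s adj_sym by blast+
    moreover have "\<not> s \<rightarrow>\<^bsub>G\<^esub> t" using \<open>stable S\<close> s t by (auto simp: stable_def)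
    moreover have "s \<in> T" "k \<in> T" "l \<in> T" "t \<in> T" using s t k(1) l assms(3,8) by auto
    \<comment> \<open>Otherwise \<open>s\<close>, \<open>k\<close>, \<open>l\<close>,
      \<open>t\<close> would be, in this order, an induced path on four vertices.\<close>
    ultimately show False using t \<open>P4_free_on T\<close> unfolding P4_free_on_def by blast
  qed
  then have "\<forall>l\<in>K. s \<rightarrow>\<^bsub>G\<^esub> l" using adj_sym by blast
  moreover have "s \<in> verts G" using s(1) assms(1,3) by blast
  ultimately show ?thesis using s(1) \<open>clique G K\<close> by (auto simp: clique_insert)
qed

text \<open>By induction on \<open>T\<close>, a maximal stable set \<open>S\<close> is removed and
  given one new colour. A maximum clique of \<open>T - S\<close> extends by a vertex of
  \<open>S\<close>, so the removal lowers the clique number and the new colour is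
  affordable.\<close>

lemma P4_free_colourable:
  assumes "T \<subseteq> verts G" "P4_free_on T"
  shows "colourable (omega T) T"
proof -
  have "finite T" using assms(1) finite_verts by (rule finite_subset)
  then show ?thesis using assms
  proof (induction T rule: finite_psubset_induct)
    case (psubset T)
    show ?case
    proof (cases "T = {}")
      case True
      then show ?thesis by (simp add: colourable_def proper_colouring_induce_subgraph)
    next
      case False
      have "finite {S. S \<subseteq> T \<and> stable S}" "{} \<in> {S. S \<subseteq> T \<and> stable S}"
        using psubset.hyps by (auto simp: stable_def)
      then obtain S where S: "S \<subseteq> T" "stable S"
        and "\<And>S'. S' \<subseteq> T \<Longrightarrow> stable S' \<Longrightarrow> S \<subseteq> S' \<Longrightarrow> S' = S"
        using finite_has_maximal2[of "{S. S \<subseteq> T \<and> stable S}" "{}"] by (auto, metis)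
      then have "\<not> stable (insert v S)" if "v \<in> T - S" for v
        using that by blast
      then have max: "\<exists>s\<in>S. v \<rightarrow>\<^bsub>G\<^esub> s" if "v \<in> T - S" for v
        using that S adj_sym unfolding stable_def by (metis adj_irrefl insertE)
      have "S \<noteq> {}" using max False by auto
      then have TS: "T - S \<subset> T" using S by auto
      have "omega (T - S) < omega T"
      proof -
        obtain K where K: "clique G K" "K \<subseteq> T - S" "card K = omega (T - S)"
          using psubset.prems(1) omega_cliqueE[of "T - S"] by (metis Diff_subset order.trans)
        obtain s where s: "s \<in> S" "clique G (insert s K)"
          using P4_free_clique_extends[of T S K] psubset.prems S max \<open>S \<noteq> {}\<close> K(1,2) by metis
        then have "card (insert s K) \<le> omega T"
          using K S psubset.prems(1) by (intro card_clique_le_omega) auto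
        moreover have "s \<notin> K" using s K by auto
        ultimately show ?thesis using K by (simp add: clique_finite)
      qed
      have "P4_free_on (T - S)"
        using psubset.prems(2) by (simp add: P4_free_on_def)
      then have "colourable (omega (T - S)) (T - S)"
        using psubset.IH[OF TS] psubset.prems(1) by auto
      then obtain c where c: "proper_colouring (G \<restriction> (T - S)) (omega (T - S)) c"
        by (auto simp: colourable_def)
      \<comment> \<open>The colours of \<open>c\<close> lie below \<open>omega (T - S)\<close>, so
        this number itself is the new colour.\<close>
      have "proper_colouring (G \<restriction> T) (omega T) (\<lambda>v. if v \<in> S then omega (T - S) else c v)"
        unfolding proper_colouring_induce_subgraph
      proof (intro conjI ballI impI)
        fix v assume "v \<in> T"
        then have "v \<in> T - S \<Longrightarrow> c v < omega (T - S)"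
          using c by (auto simp: proper_colouring_induce_subgraph)
        then show "(if v \<in> S then omega (T - S) else c v) < omega T"
          using \<open>omega (T - S) < omega T\<close> \<open>v \<in> T\<close> by auto
      next
        fix u v assume "u \<in> T" "v \<in> T" "u \<rightarrow>\<^bsub>G\<^esub> v"
        then have "\<not> (u \<in> S \<and> v \<in> S)" using S(2) by (auto simp: stable_def)
        moreover have "c w < omega (T - S)" if "w \<in> T" "w \<notin> S" for w
          using c that by (auto simp: proper_colouring_induce_subgraph)
        then have "u \<notin> S \<Longrightarrow> c u < omega (T - S)" "v \<notin> S \<Longrightarrow> c v < omega (T - S)"
          using \<open>u \<in> T\<close> \<open>v \<in> T\<close> by auto
        moreover have "u \<notin> S \<Longrightarrow> v \<notin> S \<Longrightarrow> c u \<noteq> c v"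
          using c \<open>u \<in> T\<close> \<open>v \<in> T\<close> \<open>u \<rightarrow>\<^bsub>G\<^esub> v\<close>
          by (simp add: proper_colouring_induce_subgraph)
        ultimately show "(if u \<in> S then omega (T - S) else c u) \<noteq>
            (if v \<in> S then omega (T - S) else c v)"
          by auto
      qed
      then show ?thesis by (auto simp: colourable_def)
    qed
  qed
qed

lemma P4_free_perfect:
  assumes "T \<subseteq> verts G" "P4_free_on T"
  shows "perfect (G \<restriction> T)"
proof -
  have "P4_free_on U" if "U \<subseteq> T" for U
    using assms(2) that unfolding P4_free_on_def by (meson subsetD)
  with assms(1) show ?thesis
    by (auto simp: perfect_iff_colourable intro!: P4_free_colourable)
qed

section \<open>Operations that preserve divisibility\<close>

text \<open>The vertex \<open>x\<close> joins the part that contains its twin: \<open>A\<close>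
  stays perfect, or the clique number of \<open>B\<close> does not grow.\<close>

lemma divisible_if_false_twins:
  assumes "x \<in> verts G" "y \<in> verts G" "x \<noteq> y"
    and twin: "\<And>v. x \<rightarrow>\<^bsub>G\<^esub> v \<longleftrightarrow> y \<rightarrow>\<^bsub>G\<^esub> v"
    and "divisible (verts G - {x})"
  shows "divisible (verts G)"
proof -
  obtain A B where AB: "A \<union> B = verts G - {x}" "A \<inter> B = {}" "perfect (G \<restriction> A)"
      "omega B < omega (verts G - {x})"
    using assms(5) by (auto simp: divisible_def)
  have sub: "A \<subseteq> verts G" "B \<subseteq> verts G" using AB(1) by auto
  have less: "omega B < omega (verts G)"
    using AB(4) omega_mono[of "verts G - {x}" "verts G"] by auto
  show ?thesis
  proof (cases "y \<in> A")
    case True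
    then have "perfect (G \<restriction> insert x A)"
      using perfect_insert_false_twin sub AB(3) assms(1) twin by blast
    then show ?thesis
      unfolding divisible_def using AB less assms(1)
      by (intro exI[of _ "insert x A"] exI[of _ B]) auto
  next
    case False
    then have "y \<in> B" using AB(1) assms(2,3) by auto
    then have "omega (insert x B) \<le> omega B"
      using omega_insert_false_twin sub assms(1) twin by blast
    then show ?thesis
      unfolding divisible_def using AB less assms(1)
      by (intro exI[of _ A] exI[of _ "insert x B"]) auto
  qed
qed

text \<open>The simplicial vertex always goes to the perfect part, leaving \<open>B\<close> as it
  was.\<close>

lemma divisible_if_simplicial:
  assumes "x \<in> verts G" "clique G {v. x \<rightarrow>\<^bsub>G\<^esub> v}" "divisible (verts G - {x})"
  shows "divisible (verts G)"
proof -
  obtain A B where AB: "A \<union> B = verts G - {x}" "A \<inter> B = {}" "perfect (G \<restriction> A)"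
      "omega B < omega (verts G - {x})"
    using assms(3) by (auto simp: divisible_def)
  have "omega B < omega (verts G)"
    using AB(4) omega_mono[of "verts G - {x}" "verts G"] by auto
  moreover have "A \<subseteq> verts G" using AB(1) by auto
  then have "perfect (G \<restriction> insert x A)"
    using perfect_insert_simplicial AB(3) assms(1,2) by blast
  ultimately show ?thesis
    unfolding divisible_def using AB assms(1)
    by (intro exI[of _ "insert x A"] exI[of _ B]) auto
qed

text \<open>The divisions are united part by part; every clique of \<open>B \<union> D\<close> stays
  on one side and is small there.\<close>

lemma divisible_anticomplete_Un:
  assumes "S \<subseteq> verts G" "T \<subseteq> verts G" "S \<inter> T = {}" "divisible S" "divisible T"
    and anti: "\<And>u v. \<lbrakk>u \<in> S; v \<in> T\<rbrakk> \<Longrightarrow> \<not> u \<rightarrow>\<^bsub>G\<^esub> v"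
  shows "divisible (S \<union> T)"
proof -
  obtain A B where AB: "A \<union> B = S" "A \<inter> B = {}" "perfect (G \<restriction> A)" "omega B < omega S"
    using assms(4) by (auto simp: divisible_def)
  obtain C D where CD: "C \<union> D = T" "C \<inter> D = {}" "perfect (G \<restriction> C)" "omega D < omega T"
    using assms(5) by (auto simp: divisible_def)
  have sub: "A \<subseteq> S" "B \<subseteq> S" "C \<subseteq> T" "D \<subseteq> T" using AB(1) CD(1) by auto
  have mono: "omega S \<le> omega (S \<union> T)" "omega T \<le> omega (S \<union> T)"
    using assms by (auto intro!: omega_mono)
  have "perfect (G \<restriction> (A \<union> C))"
  proof (rule perfect_anticomplete_Un)
    show "\<not> u \<rightarrow>\<^bsub>G\<^esub> v" if "u \<in> A" "v \<in> C" for u v using that sub anti by blast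
  qed (use AB CD sub assms in auto)
  moreover have "omega (B \<union> D) < omega (S \<union> T)"
  proof (rule omega_anticomplete_less)
    show "\<not> u \<rightarrow>\<^bsub>G\<^esub> v" if "u \<in> B" "v \<in> D" for u v using that sub anti by blast
  qed (use AB(4) CD(4) mono sub assms in auto)
  ultimately show ?thesis
    unfolding divisible_def using AB(1,2) CD(1,2) assms(3)
    by (intro exI[of _ "A \<union> C"] exI[of _ "B \<union> D"]) auto
qed

text \<open>All of \<open>N\<close> can go to \<open>B\<close>: it raises the clique number of
  \<open>B\<close> by at most \<open>omega N\<close>, and that of \<open>X\<close> by at least as
  much. The set \<open>M\<close> goes to \<open>A\<close>, to which it is anticomplete.\<close>

lemma divisible_homogeneous:
  assumes V: "verts G = X \<union> N \<union> M" and disj: "X \<inter> N = {}" "X \<inter> M = {}" "N \<inter> M = {}"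
    and complete: "\<And>u v. \<lbrakk>u \<in> X; v \<in> N\<rbrakk> \<Longrightarrow> u \<rightarrow>\<^bsub>G\<^esub> v"
    and anti: "\<And>u v. \<lbrakk>u \<in> X; v \<in> M\<rbrakk> \<Longrightarrow> \<not> u \<rightarrow>\<^bsub>G\<^esub> v"
    and "divisible X" "perfect (G \<restriction> M)"
  shows "divisible (verts G)"
proof -
  obtain A B where AB: "A \<union> B = X" "A \<inter> B = {}" "perfect (G \<restriction> A)" "omega B < omega X"
    using \<open>divisible X\<close> by (auto simp: divisible_def)
  have "perfect (G \<restriction> (A \<union> M))"
  proof (rule perfect_anticomplete_Un)
    show "\<not> u \<rightarrow>\<^bsub>G\<^esub> v" if "u \<in> A" "v \<in> M" for u v using that AB(1) anti by blast
  qed (use AB V \<open>perfect (G \<restriction> M)\<close> in auto)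
  moreover have "omega (B \<union> N) < omega (verts G)"
  proof -
    have "omega (B \<union> N) \<le> omega B + omega N"
      using V AB(1) by (intro omega_Un_le) auto
    also have "\<dots> < omega X + omega N" using AB(4) by simp
    also have "\<dots> \<le> omega (X \<union> N)"
      using V complete by (intro omega_join_ge) auto
    also have "\<dots> \<le> omega (verts G)"
      using V by (intro omega_mono) auto
    finally show ?thesis .
  qed
  ultimately show ?thesis
    unfolding divisible_def using AB(1,2) V disj
    by (intro exI[of _ "A \<union> M"] exI[of _ "B \<union> N"]) auto
qed

section \<open>Minimality in terms of vertex subsets\<close>

lemma induce_subgraph_verts_self: "G \<restriction> verts G = G"
  by (rule induce_eq_iff_induced[OF induced_subgraph_refl])

lemma perfect_division_iff_divisible:
  "(\<exists>A B. perfect_division (G \<restriction> S) A B) \<longleftrightarrow> divisible S"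
  unfolding perfect_division_def divisible_def
  by (intro iff_exI) (auto simp: induce_subgraph_induce_subgraph)

lemma perfectly_divisible_induce_iff:
  assumes "S \<subseteq> verts G"
  shows "perfectly_divisible (G \<restriction> S) \<longleftrightarrow> (\<forall>T\<subseteq>S. T \<noteq> {} \<longrightarrow> divisible T)"
proof -
  have "perfectly_divisible (G \<restriction> S) \<longleftrightarrow>
      (\<forall>T\<subseteq>S. verts (G \<restriction> T) \<noteq> {} \<longrightarrow> (\<exists>A B. perfect_division (G \<restriction> T) A B))"
    unfolding perfectly_divisible_def induced_subgraph_induce_iff by blast
  then show ?thesis by (simp add: perfect_division_iff_divisible)
qed

text \<open>Proper nonempty subsets are divisible by minimality; if the full vertex set were
  divisible too, \<open>G\<close> would be perfectly divisible.\<close>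

lemma minimally_nonperfectly_divisibleD:
  assumes "minimally_nonperfectly_divisible G"
  shows "\<not> divisible (verts G)"
    and "\<And>S. S \<subset> verts G \<Longrightarrow> S \<noteq> {} \<Longrightarrow> divisible S"
proof -
  show *: "divisible S" if "S \<subset> verts G" "S \<noteq> {}" for S
  proof -
    have "induced_subgraph (G \<restriction> S) G" "G \<restriction> S \<noteq> G"
      using that by (auto simp: induced_induce dest: arg_cong[where f = verts])
    then have "perfectly_divisible (G \<restriction> S)"
      using assms by (auto simp: minimally_nonperfectly_divisible_def)
    with that show ?thesis by (auto simp: perfectly_divisible_induce_iff)
  qed
  have "\<not> perfectly_divisible (G \<restriction> verts G)"
    using assms by (simp add: minimally_nonperfectly_divisible_def induce_subgraph_verts_self)
  with * show "\<not> divisible (verts G)"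
    by (auto simp: perfectly_divisible_induce_iff)
qed

section \<open>Consequences of the forbidden subgraphs\<close>

text \<open>If \<open>a\<close> and \<open>b\<close> were nonadjacent, they would form a diamond
  with the edge \<open>c\<close>, \<open>d\<close>. They are listed first because the missing edge
  of \<open>diamond\<close> joins 0 and 1.\<close>

lemma diamond_freeD:
  assumes "free_of diamond G" "a \<rightarrow>\<^bsub>G\<^esub> c" "a \<rightarrow>\<^bsub>G\<^esub> d" "b \<rightarrow>\<^bsub>G\<^esub> c" "b \<rightarrow>\<^bsub>G\<^esub> d" "c \<rightarrow>\<^bsub>G\<^esub> d" "a \<noteq> b"
  shows "a \<rightarrow>\<^bsub>G\<^esub> b"
proof (rule ccontr)
  assume ab: "\<not> a \<rightarrow>\<^bsub>G\<^esub> b"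
  have "\<not> free_of (with_proj diamond) G"
  proof (rule not_free_ofI[where f = "(!) [a, b, c, d]"])
    show "pair_wf_digraph diamond"
      using pair_graph_diamond pair_graph_def pair_digraph_def pair_fin_digraph_def by blast
    have sym: "c \<rightarrow>\<^bsub>G\<^esub> a" "d \<rightarrow>\<^bsub>G\<^esub> a" "c \<rightarrow>\<^bsub>G\<^esub> b" "d \<rightarrow>\<^bsub>G\<^esub> b" "d \<rightarrow>\<^bsub>G\<^esub> c" "\<not> b \<rightarrow>\<^bsub>G\<^esub> a"
      using assms ab adj_sym by blast+
    have ne: "a \<noteq> c" "a \<noteq> d" "b \<noteq> c" "b \<noteq> d" "c \<noteq> d" using assms by auto
    show "inj_on ((!) [a, b, c, d]) (pverts diamond)"
      using ne \<open>a \<noteq> b\<close> by (auto simp: diamond_def inj_on_def less_Suc_eq numeral_eq_Suc)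
    show "(!) [a, b, c, d] ` pverts diamond \<subseteq> verts G"
      using assms by (auto simp: diamond_def less_Suc_eq numeral_eq_Suc adj_in_verts)
    show "[a, b, c, d] ! i \<rightarrow>\<^bsub>G\<^esub> [a, b, c, d] ! j \<longleftrightarrow> (i, j) \<in> parcs diamond"
      if "i \<in> pverts diamond" "j \<in> pverts diamond" for i j
      using that assms ab sym by (auto simp: diamond_def less_Suc_eq numeral_eq_Suc)
  qed unfold_locales
  with assms(1) show False by blast
qed

text \<open>An induced \<open>P\<^sub>4\<close> in \<open>M\<close> would form
  \<open>P\<^sub>2 \<union> P\<^sub>4\<close> together with the edge \<open>a\<close>,
  \<open>b\<close>, which sends no edge to \<open>M\<close>.\<close>

lemma P2_P4_freeD:
  assumes "free_of (disjoint_union (path_graph 2) (path_graph 4)) G"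
    and "a \<rightarrow>\<^bsub>G\<^esub> b" and "M \<subseteq> verts G"
    and anti: "\<And>v. v \<in> M \<Longrightarrow> \<not> a \<rightarrow>\<^bsub>G\<^esub> v \<and> \<not> b \<rightarrow>\<^bsub>G\<^esub> v"
    and "a \<notin> M" "b \<notin> M"
  shows "P4_free_on M"
proof (rule ccontr)
  assume "\<not> P4_free_on M"
  then obtain p q r s where M: "p \<in> M" "q \<in> M" "r \<in> M" "s \<in> M"
    and pos: "p \<rightarrow>\<^bsub>G\<^esub> q" "q \<rightarrow>\<^bsub>G\<^esub> r" "r \<rightarrow>\<^bsub>G\<^esub> s"
    and neg: "\<not> p \<rightarrow>\<^bsub>G\<^esub> r" "\<not> q \<rightarrow>\<^bsub>G\<^esub> s" "\<not> p \<rightarrow>\<^bsub>G\<^esub> s"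
    unfolding P4_free_on_def by blast
  have pos': "q \<rightarrow>\<^bsub>G\<^esub> p" "r \<rightarrow>\<^bsub>G\<^esub> q" "s \<rightarrow>\<^bsub>G\<^esub> r" "b \<rightarrow>\<^bsub>G\<^esub> a"
    and neg': "\<not> r \<rightarrow>\<^bsub>G\<^esub> p" "\<not> s \<rightarrow>\<^bsub>G\<^esub> q" "\<not> s \<rightarrow>\<^bsub>G\<^esub> p"
    using pos neg assms(2) adj_sym by blast+
  have cross: "\<not> a \<rightarrow>\<^bsub>G\<^esub> v" "\<not> b \<rightarrow>\<^bsub>G\<^esub> v" "\<not> v \<rightarrow>\<^bsub>G\<^esub> a" "\<not> v \<rightarrow>\<^bsub>G\<^esub> b" if "v \<in> M" for v
    using that anti adj_sym by blast+
  have ne: "a \<noteq> b" "p \<noteq> q" "p \<noteq> r" "p \<noteq> s" "q \<noteq> r" "q \<noteq> s" "r \<noteq> s"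
    using pos neg neg' assms(2) by auto
  let ?F = "disjoint_union (path_graph 2) (path_graph 4)"
  let ?f = "case_sum ((!) [a, b]) ((!) [p, q, r, s])"
  have pverts: "pverts ?F = {Inl 0, Inl 1, Inr 0, Inr 1, Inr 2, Inr 3}"
    by (auto simp: disjoint_union_def path_graph_def less_Suc_eq numeral_eq_Suc)
  have parcs: "parcs ?F = {(Inl 0, Inl 1), (Inl 1, Inl 0), (Inr 0, Inr 1), (Inr 1, Inr 0),
      (Inr 1, Inr 2), (Inr 2, Inr 1), (Inr 2, Inr 3), (Inr 3, Inr 2)}"
    by (auto simp: disjoint_union_def path_graph_def less_Suc_eq numeral_eq_Suc)
  have "\<not> free_of (with_proj ?F) G"
  proof (rule not_free_ofI[where f = ?f])
    show "pair_wf_digraph ?F"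
      using pair_graph_disjoint_union[OF pair_graph_path_graph pair_graph_path_graph]
        pair_graph_def pair_digraph_def pair_fin_digraph_def by blast
    show "inj_on ?f (pverts ?F)"
      unfolding pverts using ne M assms(5,6) by auto
    show "?f ` pverts ?F \<subseteq> verts G"
      unfolding pverts using M assms(2,3) adj_in_verts by auto
    show "?f i \<rightarrow>\<^bsub>G\<^esub> ?f j \<longleftrightarrow> (i, j) \<in> parcs ?F"
      if "i \<in> pverts ?F" "j \<in> pverts ?F" for i j
      \<comment> \<open>The equivalence is checked separately for each of the 36 ordered pairs of
        vertices.\<close>
      using that unfolding pverts parcs insert_iff empty_iff
      by (elim disjE FalseE; simp add: pos pos' neg neg' assms(2) cross M)
  qed unfold_locales
  with assms(1) show False by blast
qed

end

section \<open>Exclusion of homogeneous sets\<close>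

theorem theorem3:
  fixes G :: "('a, 'b) pre_digraph"
  assumes "graph G"
    and "free_of (disjoint_union (path_graph 2) (path_graph 4)) G \<or> free_of diamond G"
    and "minimally_nonperfectly_divisible G"
  shows "\<not> (\<exists>X. homogeneous_set G X)"
proof
  assume "\<exists>X. homogeneous_set G X"
  then obtain X where X: "homogeneous_set G X" by blast
  interpret graph G by fact
  note not_div = minimally_nonperfectly_divisibleD(1)[OF assms(3)]
  note div = minimally_nonperfectly_divisibleD(2)[OF assms(3)]
  have XV: "X \<subseteq> verts G" and "1 < card X" and "card X < card (verts G)"
    and hom: "\<And>v. v \<in> verts G - X \<Longrightarrow> (\<forall>x\<in>X. v \<rightarrow>\<^bsub>G\<^esub> x) \<or> (\<forall>x\<in>X. \<not> v \<rightarrow>\<^bsub>G\<^esub> x)"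
    using X by (auto simp: homogeneous_set_def)
  have "X \<subset> verts G" using XV \<open>card X < card (verts G)\<close> by auto
  \<comment> \<open>One pair serves all cases: the ends of an edge if \<open>X\<close> has one, and
    otherwise two arbitrary vertices, which will be false twins.\<close>
  obtain a b where ab: "a \<in> X" "b \<in> X" "a \<noteq> b"
    and edge: "a \<rightarrow>\<^bsub>G\<^esub> b \<or> stable X"
  proof -
    obtain a b where "a \<in> X" "b \<in> X" "a \<noteq> b"
      using \<open>1 < card X\<close> by (metis card_le_Suc0_iff_eq One_nat_def card.infinite linorder_not_less zero_le)
    moreover have "stable X \<or> (\<exists>a\<in>X. \<exists>b\<in>X. a \<rightarrow>\<^bsub>G\<^esub> b \<and> a \<noteq> b)"
      unfolding stable_def by (metis adj_irrefl)
    ultimately show thesis using that by blast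
  qed
  have divX: "divisible X" using div \<open>X \<subset> verts G\<close> ab by blast
  have div_del: "divisible (verts G - {x})" if "x \<in> X" for x
    using that div[of "verts G - {x}"] ab XV by blast
  define N where "N = {v \<in> verts G - X. \<forall>x\<in>X. v \<rightarrow>\<^bsub>G\<^esub> x}"
  define M where "M = {v \<in> verts G - X. \<forall>x\<in>X. \<not> v \<rightarrow>\<^bsub>G\<^esub> x}"
  have V: "verts G = X \<union> N \<union> M" using XV hom by (auto simp: N_def M_def)
  have disj: "X \<inter> N = {}" "X \<inter> M = {}" "N \<inter> M = {}" using ab by (auto simp: N_def M_def)
  have complete: "u \<rightarrow>\<^bsub>G\<^esub> v" if "u \<in> X" "v \<in> N" for u v
    using that adj_sym by (auto simp: N_def)
  have anti: "\<not> u \<rightarrow>\<^bsub>G\<^esub> v" if "u \<in> X" "v \<in> M" for u v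
    using that adj_sym by (auto simp: M_def)
  have nbr: "v \<in> X \<or> v \<in> N" if "u \<in> X" "u \<rightarrow>\<^bsub>G\<^esub> v" for u v
    using that anti V adj_in_verts(2) by blast
  show False
  proof (cases "stable X")
    case True
    \<comment> \<open>A vertex of the stable set \<open>X\<close> has exactly the vertices of
      \<open>N\<close> as neighbours.\<close>
    then have "a \<rightarrow>\<^bsub>G\<^esub> v \<longleftrightarrow> b \<rightarrow>\<^bsub>G\<^esub> v" for v
      using ab nbr complete unfolding stable_def by blast
    then show False
      using divisible_if_false_twins[of a b] ab XV div_del not_div by blast
  next
    case False
    with edge have edge: "a \<rightarrow>\<^bsub>G\<^esub> b" by simp
    from assms(2) show False
    proof
      assume F: "free_of (disjoint_union (path_graph 2) (path_graph 4)) G"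
      have "P4_free_on M"
        using F edge by (rule P2_P4_freeD) (use ab anti disj V in auto)
      then have "perfect (G \<restriction> M)" using V by (intro P4_free_perfect) auto
      then show False
        using divisible_homogeneous[OF V disj complete anti divX] not_div by blast
    next
      assume F: "free_of diamond G"
      show False
      proof (cases "N = {}")
        case True
        then have "M \<subset> verts G" "M \<noteq> {}" using V ab \<open>X \<subset> verts G\<close> disj by auto
        then have "divisible (X \<union> M)"
          using V disj divX anti div by (intro divisible_anticomplete_Un) auto
        then show False using not_div V True by simp
      next
        case False
        then obtain n where n: "n \<in> N" by blast
        \<comment> \<open>The vertex \<open>a\<close> is simplicial: its neighbours lie in
          \<open>X\<close> or \<open>N\<close>, and a neighbour in \<open>X\<close> is adjacent to
          every one in \<open>N\<close>. Only pairs on the same side need the absence of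
          diamonds.\<close>
        have "clique G {v. a \<rightarrow>\<^bsub>G\<^esub> v}"
          unfolding clique_def
        proof (intro conjI ballI impI)
          show "{v. a \<rightarrow>\<^bsub>G\<^esub> v} \<subseteq> verts G" using adj_in_verts by auto
          fix u v assume "u \<in> {v. a \<rightarrow>\<^bsub>G\<^esub> v}" "v \<in> {v. a \<rightarrow>\<^bsub>G\<^esub> v}" "u \<noteq> v"
          then have uv: "a \<rightarrow>\<^bsub>G\<^esub> u" "a \<rightarrow>\<^bsub>G\<^esub> v" "u \<noteq> v" by auto
          have cases: "u \<in> X \<or> u \<in> N" "v \<in> X \<or> v \<in> N" using nbr ab uv by blast+
          show "u \<rightarrow>\<^bsub>G\<^esub> v"
          proof (cases "u \<in> N \<and> v \<in> N")
            case True
            \<comment> \<open>Both vertices of \<open>N\<close> are adjacent to both ends of the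
              edge \<open>a\<close>, \<open>b\<close>.\<close>
            then show ?thesis
              using diamond_freeD[OF F _ _ _ _ edge uv(3)] complete ab adj_sym by blast
          next
            case False
            then consider "u \<in> X" "v \<in> X" | "u \<in> X" "v \<in> N" | "u \<in> N" "v \<in> X"
              using cases by blast
            then show ?thesis
            proof cases
              case 1
              \<comment> \<open>Both vertices of \<open>X\<close> are neighbours of \<open>a\<close>
                and of \<open>n\<close>, hence adjacent to both ends of the edge \<open>a\<close>,
                \<open>n\<close>.\<close>
              then show ?thesis
                using diamond_freeD[OF F _ _ _ _ complete[OF ab(1) n] uv(3)] complete n uv adj_sym
                by blast
            qed (use complete adj_sym in blast)+
          qed
        qed
        then show False
          using divisible_if_simplicial[of a] ab XV div_del not_div by blast
      qed
    qed
  qed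
qed

end
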